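(* Let $\mathbf U\subset\mathbb R^d$ be a closed convex set with nonempty interior, and let $X:(\Omega,\mathcal A,\mathbb P)\to\mathbb R^d$ be a square integrable random vector whose distribution $\mu$ has support contained in $\mathbf U$. Let $N\ge2$ be such that $\operatorname{card}(\operatorname{supp}\mu)>N$. Let $\Gamma^*_{N-1}=\{x_1^*,\dots,x_{N-1}^*\}\subset\mathbf U$ be an optimal grid of size $N-1$ for $\mu$, i.e. $|\Gamma^*_{N-1}|=N-1$ and $e(\Gamma^*_{N-1},X)=e_{N-1}(X)$, and let $x_N^{(0)}\in\operatorname{supp}(\mu)\setminus\Gamma^*_{N-1}$. Let $(\Gamma^{(k)})_{k\ge0}$ be the Lloyd iterates started at $$\Gamma^{(0)}=\Gamma^*_{N-1}\cup\{x_N^{(0)}\},$$ and $(x^{(k)})_{k\ge 0}$ a consistent representation of them. Then: (a) The quantization error induced by $\Gamma^{(0)}$ is strictly smaller than $e_{N-1}(X)$, so that for every $k\ge0$, $|\Gamma^{(k)}|=N$ and $$e(\Gamma^{(k)},X)\le e(\Gamma^{(0)},X)<e_{N-1}(X).$$ (b) The sequence of iterated grids is bounded: there exists a compact set $K\subset\mathbb R^d$ such that $\Gamma^{(k)}\subset K$ for every $k\in\mathbb N$. (c) All the limiting values (limits of subsequences) in $(\mathbb R^d)^N$ of the sequence $(x^{(k)})_{k\ge0}$ have $N$ pairwise distinct components.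
   Context: $|\cdot|$ is the canonical Euclidean norm on $\mathbb R^d$; $|A|$ also denotes the cardinality of a finite set $A$. No continuity assumption is made on $\mu$. Voronoi partition: for a finite set (grid) $\Gamma=\{x_1,\dots,x_N\}\subset\mathbb R^d$, a Voronoi partition $(C_i(\Gamma))_{1\le i\le N}$ is a Borel partition of $\mathbb R^d$ with $C_i(\Gamma)\subset\{\xi: |\xi-x_i|=\min_{j}|\xi-x_j|\}$. One such (arbitrary) partition is fixed for each grid $\Gamma$. Quantization error: $e(\Gamma,X)=\big(\mathbb E\min_{a\in\Gamma}|X-a|^2\big)^{1/2}$. Minimal error at level $n\ge1$: $e_n(X)=\inf\{e(\Gamma,X):\Gamma\subset\mathbb R^d,\ 1\le|\Gamma|\le n\}$. Lloyd iterates and consistent representation: number $\Gamma^{(0)}=\{x^{(0)}_1,\dots,x^{(0)}_N\}$ and set recursively $\Gamma^{(k)}=\{x^{(k)}_1,\dots,x^{(k)}_N\}$ with $$x^{(k+1)}_i=\frac{\mathbb E\big(X\mathbf 1_{\{X\in C_i(\Gamma^{(k)})\}}\big)}{\mathbb P\big(X\in C_i(\Gamma^{(k)})\big)}\ \text{ if } \mathbb P\big(X\in C_i(\Gamma^{(k)})\big)>0,\qquad x_i^{(k+1)}=x_i^{(k)}\ \text{ otherwise},$$ where $C_i(\Gamma^{(k)})$ denotes the cell of the point $x_i^{(k)}$ (coinciding components, if any, share the same cell). The sequence of $N$-tuples $(x^{(k)})_{k\ge0}$ is called a consistent representation of $(\Gamma^{(k)})_{k\ge 0}$. *)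

theory Defs
  imports "HOL-Probability.Probability"
begin

definition measure_support :: "'a::topological_space measure \<Rightarrow> 'a set" where
  "measure_support \<mu> = {x. \<forall>W. open W \<and> x \<in> W \<longrightarrow> 0 < emeasure \<mu> W}"

text \<open>Cells are indexed by the points of the grid rather than by a numbering of them,
  so that coinciding components of a tuple share the same cell.\<close>

definition voronoi_partition :: "'a::euclidean_space set \<Rightarrow> ('a \<Rightarrow> 'a set) \<Rightarrow> bool" where
  "voronoi_partition \<Gamma> C \<longleftrightarrow>
     (\<forall>a\<in>\<Gamma>. C a \<in> sets borel) \<and>
     disjoint_family_on C \<Gamma> \<and> (\<Union>a\<in>\<Gamma>. C a) = UNIV \<and>
     (\<forall>a\<in>\<Gamma>. C a \<subseteq> {\<xi>. norm (\<xi> - a) = Min ((\<lambda>b. norm (\<xi> - b)) ` \<Gamma>)})"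

definition quantization_error ::
    "'w measure \<Rightarrow> ('w \<Rightarrow> 'a::euclidean_space) \<Rightarrow> 'a set \<Rightarrow> real" where
  "quantization_error M X \<Gamma> = sqrt (\<integral>\<omega>. Min ((\<lambda>a. (norm (X \<omega> - a))\<^sup>2) ` \<Gamma>) \<partial>M)"

definition minimal_quantization_error ::
    "'w measure \<Rightarrow> ('w \<Rightarrow> 'a::euclidean_space) \<Rightarrow> nat \<Rightarrow> real" where
  "minimal_quantization_error M X n =
     Inf {quantization_error M X \<Gamma> | \<Gamma>. finite \<Gamma> \<and> 1 \<le> card \<Gamma> \<and> card \<Gamma> \<le> n}"

definition lloyd_update ::
    "'w measure \<Rightarrow> ('w \<Rightarrow> 'a::euclidean_space) \<Rightarrow> ('a \<Rightarrow> 'a set) \<Rightarrow> 'a \<Rightarrow> 'a" where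
  "lloyd_update M X C a =
     (let p = measure M {\<omega> \<in> space M. X \<omega> \<in> C a}
      in if p > 0 then (\<integral>\<omega>. indicator (C a) (X \<omega>) *\<^sub>R X \<omega> \<partial>M) /\<^sub>R p else a)"

text \<open>Here \<open>C \<Gamma>\<close> is the Voronoi partition fixed for the grid \<open>\<Gamma>\<close>, \<open>G k\<close> is the \<open>k\<close>-th Lloyd
  iterate, and the \<open>N\<close>-tuple \<open>x k\<close> representing it is read only at the indices \<open>1, ..., N\<close>.\<close>

definition consistent_representation ::
    "'w measure \<Rightarrow> ('w \<Rightarrow> 'a::euclidean_space) \<Rightarrow> ('a set \<Rightarrow> 'a \<Rightarrow> 'a set) \<Rightarrow> nat \<Rightarrow>
     (nat \<Rightarrow> 'a set) \<Rightarrow> (nat \<Rightarrow> nat \<Rightarrow> 'a) \<Rightarrow> bool" where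
  "consistent_representation M X C N G x \<longleftrightarrow>
     (\<forall>k. G k = x k ` {1..N}) \<and>
     (\<forall>k. \<forall>i\<in>{1..N}. x (Suc k) i = lloyd_update M X (C (G k)) (x k i))"

end

theory Submission
  imports Defs
begin

text \<open>
  Write \<open>D(\<Gamma>) = e(\<Gamma>, X)\<^sup>2\<close>. The three claims express that \<open>D(\<Gamma>\<^sup>(\<^sup>k\<^sup>))\<close> stays below a
  level that fewer than \<open>N\<close> points cannot reach.

  The added point \<open>x\<^sub>N\<^sup>(\<^sup>0\<^sup>)\<close> lies in the support at positive distance from the optimal grid, so it
  is strictly closer than that grid to a set of values of \<open>X\<close> of positive probability: hence
  \<open>D(\<Gamma>\<^sup>(\<^sup>0\<^sup>)) < e\<^sub>N\<^sub>-\<^sub>1(X)\<^sup>2\<close> (\<open>distortion_insert_support_less\<close>). A Lloyd step does not increase \<open>D\<close>,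
  since on each cell the conditional mean is the best constant approximation of \<open>X\<close>
  (\<open>distortion_lloyd_le\<close>). So every iterate lies in the sublevel set \<open>{D \<le> c}\<close> with
  \<open>c = D(\<Gamma>\<^sup>(\<^sup>0\<^sup>)) < e\<^sub>N\<^sub>-\<^sub>1(X)\<^sup>2\<close>, and a grid of this sublevel set has at least \<open>N\<close> points.

  Boundedness is a property of this sublevel set (\<open>grids_below_removal_level_bounded\<close>): a point
  of the grid very far from the origin is only useful to the values of \<open>X\<close> that are themselves very large, so deleting it costs arbitrarily little and would
  leave at most \<open>N - 1\<close> points with \<open>D < e\<^sub>N\<^sub>-\<^sub>1(X)\<^sup>2\<close>.

  On bounded grids \<open>D\<close> is Lipschitz in the positions of the points
  (\<open>distortion_le_perturbation\<close>), so a limiting value of the iterates still satisfies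
  \<open>D \<le> c\<close> (\<open>distortion_limit_le\<close>). It therefore has \<open>N\<close> distinct points, that is, its components do not merge.
\<close>

section \<open>Squared distance to a grid\<close>

definition sq_dist_to_grid :: "'a::euclidean_space set \<Rightarrow> 'a \<Rightarrow> real" where
  "sq_dist_to_grid A \<xi> = Min ((\<lambda>a. (norm (\<xi> - a))\<^sup>2) ` A)"

lemma sq_dist_to_grid_le:
  "finite A \<Longrightarrow> a \<in> A \<Longrightarrow> sq_dist_to_grid A \<xi> \<le> (norm (\<xi> - a))\<^sup>2"
  by (simp add: sq_dist_to_grid_def)

lemma sq_dist_to_grid_nearest:
  assumes "finite A" "A \<noteq> {}"
  obtains a where "a \<in> A" "sq_dist_to_grid A \<xi> = (norm (\<xi> - a))\<^sup>2"
proof -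
  have "sq_dist_to_grid A \<xi> \<in> (\<lambda>a. (norm (\<xi> - a))\<^sup>2) ` A"
    unfolding sq_dist_to_grid_def using assms by (intro Min_in) auto
  then show thesis using that by auto
qed

lemma sq_dist_to_grid_nonneg: "finite A \<Longrightarrow> A \<noteq> {} \<Longrightarrow> 0 \<le> sq_dist_to_grid A \<xi>"
  by (metis sq_dist_to_grid_nearest zero_le_power2)

lemma sq_dist_to_grid_antimono:
  assumes "finite B" "A \<noteq> {}" "A \<subseteq> B"
  shows "sq_dist_to_grid B \<xi> \<le> sq_dist_to_grid A \<xi>"
  unfolding sq_dist_to_grid_def using assms by (intro Min_antimono) auto

lemma sq_dist_to_grid_in_cell:
  assumes V: "voronoi_partition A C" and A: "finite A" and a: "a \<in> A" and \<xi>: "\<xi> \<in> C a"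
  shows "sq_dist_to_grid A \<xi> = (norm (\<xi> - a))\<^sup>2"
proof -
  have *: "norm (\<xi> - a) = Min ((\<lambda>b. norm (\<xi> - b)) ` A)"
    using V a \<xi> unfolding voronoi_partition_def by blast
  have "norm (\<xi> - a) \<le> norm (\<xi> - b)" if "b \<in> A" for b
    unfolding * using that A by simp
  then show ?thesis
    unfolding sq_dist_to_grid_def using A a
    by (intro Min_eqI) (auto intro!: power_mono)
qed

text \<open>
  Writes an expression that depends on the cell of \<open>\<xi>\<close> as a finite sum over the grid, which can then
  be integrated term by term.
\<close>

lemma sum_over_cells:
  assumes V: "voronoi_partition A C" and A: "finite A"
  obtains a where "a \<in> A" "\<xi> \<in> C a" "\<And>g. (\<Sum>b\<in>A. indicator (C b) \<xi> * g b) = (g a :: real)"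
proof -
  obtain a where a: "a \<in> A" "\<xi> \<in> C a"
    using V unfolding voronoi_partition_def by blast
  have unique: "b = a" if "b \<in> A" "\<xi> \<in> C b" for b
    using V a that unfolding voronoi_partition_def disjoint_family_on_def by blast
  have ind: "indicator (C b) \<xi> = (if b = a then 1 else 0 :: real)" if "b \<in> A" for b
    using a(2) unique[OF that] by (cases "b = a") (auto simp: indicator_def)
  have "(\<Sum>b\<in>A. indicator (C b) \<xi> * g b) = g a" for g :: "_ \<Rightarrow> real"
  proof -
    have "(\<Sum>b\<in>A. indicator (C b) \<xi> * g b) = (\<Sum>b\<in>A. if b = a then g b else 0)"
      by (intro sum.cong) (auto simp: ind)
    then show ?thesis using A a by simp
  qed
  with a show thesis by (rule that)
qed

text \<open>
  The new nearest point \<open>a\<close> is within \<open>\<delta>\<close> of the old one \<open>b\<close>, and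
  \<open>s\<^sup>2 - t\<^sup>2 = (s - t) (s + t)\<close> with \<open>s = \<bar>\<xi> - a\<bar>\<close>, \<open>t = \<bar>\<xi> - b\<bar>\<close>.
\<close>

lemma sq_dist_to_grid_perturbation:
  assumes A: "finite A" and B: "finite B" "B \<noteq> {}"
    and bnd: "A \<subseteq> cball 0 R" "B \<subseteq> cball 0 R"
    and near: "\<And>b. b \<in> B \<Longrightarrow> \<exists>a\<in>A. norm (a - b) \<le> \<delta>"
  shows "sq_dist_to_grid A \<xi> \<le> sq_dist_to_grid B \<xi> + \<delta> * (2 * norm \<xi> + 2 * R)"
proof -
  obtain b where b: "b \<in> B" "sq_dist_to_grid B \<xi> = (norm (\<xi> - b))\<^sup>2"
    using B by (rule sq_dist_to_grid_nearest)
  obtain a where a: "a \<in> A" "norm (a - b) \<le> \<delta>" using near b(1) by blast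
  have s: "norm (\<xi> - a) + norm (\<xi> - b) \<le> 2 * norm \<xi> + 2 * R"
    using norm_triangle_ineq4[of \<xi> a] norm_triangle_ineq4[of \<xi> b] bnd a(1) b(1) by force
  have d: "norm (\<xi> - a) - norm (\<xi> - b) \<le> \<delta>"
    using norm_triangle_ineq2[of "\<xi> - a" "\<xi> - b"] a(2) by (simp add: norm_minus_commute)
  have \<delta>: "0 \<le> \<delta>" using a(2) norm_ge_zero order_trans by blast
  have "(norm (\<xi> - a))\<^sup>2 - (norm (\<xi> - b))\<^sup>2
      = (norm (\<xi> - a) - norm (\<xi> - b)) * (norm (\<xi> - a) + norm (\<xi> - b))"
    by (simp add: power2_eq_square algebra_simps)
  also have "\<dots> \<le> \<delta> * (norm (\<xi> - a) + norm (\<xi> - b))"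
    using d by (intro mult_right_mono) auto
  also have "\<dots> \<le> \<delta> * (2 * norm \<xi> + 2 * R)"
    using s \<delta> by (intro mult_left_mono) auto
  finally show ?thesis
    using sq_dist_to_grid_le[OF A a(1), of \<xi>] b(2) by linarith
qed

lemma norm_diff_squared_le: "(norm (x - y))\<^sup>2 \<le> 2 * (norm x)\<^sup>2 + 2 * (norm y)\<^sup>2"
  for x y :: "'a::real_inner"
proof -
  have "(norm (x - y))\<^sup>2 + (norm (x + y))\<^sup>2 = 2 * (norm x)\<^sup>2 + 2 * (norm y)\<^sup>2"
    by (simp add: power2_norm_eq_inner algebra_simps inner_commute)
  then show ?thesis using zero_le_power2[of "norm (x + y)"] by linarith
qed

section \<open>Distortion of a square integrable random vector\<close>

locale square_integrable_vector = prob_space M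
  for M :: "'w measure" and X :: "'w \<Rightarrow> 'a::euclidean_space" +
  assumes X_measurable [measurable]: "X \<in> borel_measurable M"
    and sq_integrable: "integrable M (\<lambda>\<omega>. (norm (X \<omega>))\<^sup>2)"
begin

definition distortion :: "'a set \<Rightarrow> real" where
  "distortion A = (\<integral>\<omega>. sq_dist_to_grid A (X \<omega>) \<partial>M)"

lemma quantization_error_eq_sqrt: "quantization_error M X A = sqrt (distortion A)"
  by (simp add: quantization_error_def distortion_def sq_dist_to_grid_def)

lemma integrable_norm: "integrable M (\<lambda>\<omega>. norm (X \<omega>))"
proof (rule Bochner_Integration.integrable_bound)
  show "integrable M (\<lambda>\<omega>. 1 + (norm (X \<omega>))\<^sup>2)" using sq_integrable by simp
  have "t \<le> 1 + t\<^sup>2" for t :: real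
    using zero_le_power2[of "t - 1"] zero_le_power2[of t]
    unfolding power2_diff power_one mult_1_right by linarith
  then show "AE \<omega> in M. norm (norm (X \<omega>)) \<le> norm (1 + (norm (X \<omega>))\<^sup>2)" by simp
qed simp

lemma integrable_vector: "integrable M X"
  using integrable_norm by (simp add: integrable_norm_iff)

lemma integrable_sq_dist: "integrable M (\<lambda>\<omega>. (norm (X \<omega> - a))\<^sup>2)"
proof (rule Bochner_Integration.integrable_bound)
  show "integrable M (\<lambda>\<omega>. 2 * (norm (X \<omega>))\<^sup>2 + 2 * (norm a)\<^sup>2)" using sq_integrable by simp
  show "AE \<omega> in M. norm ((norm (X \<omega> - a))\<^sup>2) \<le> norm (2 * (norm (X \<omega>))\<^sup>2 + 2 * (norm a)\<^sup>2)"
    using norm_diff_squared_le[of _ a] by simp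
qed simp

lemma integrable_sq_dist_to_grid:
  assumes A: "finite A" "A \<noteq> {}"
  shows "integrable M (\<lambda>\<omega>. sq_dist_to_grid A (X \<omega>))"
proof -
  obtain a where a: "a \<in> A" using A by blast
  show ?thesis
  proof (rule Bochner_Integration.integrable_bound[OF integrable_sq_dist[of a]])
    show "(\<lambda>\<omega>. sq_dist_to_grid A (X \<omega>)) \<in> borel_measurable M"
      unfolding sq_dist_to_grid_def using A by measurable
    show "AE \<omega> in M. norm (sq_dist_to_grid A (X \<omega>)) \<le> norm ((norm (X \<omega> - a))\<^sup>2)"
      using sq_dist_to_grid_le[OF A(1) a] sq_dist_to_grid_nonneg[OF A] by simp
  qed
qed

lemma distortion_nonneg: "finite A \<Longrightarrow> A \<noteq> {} \<Longrightarrow> 0 \<le> distortion A"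
  unfolding distortion_def by (simp add: sq_dist_to_grid_nonneg)

lemma distortion_le_perturbation:
  assumes A: "finite A" "A \<noteq> {}" and B: "finite B" "B \<noteq> {}"
    and bnd: "A \<subseteq> cball 0 R" "B \<subseteq> cball 0 R"
    and near: "\<And>b. b \<in> B \<Longrightarrow> \<exists>a\<in>A. norm (a - b) \<le> \<delta>"
  shows "distortion A \<le> distortion B + \<delta> * (2 * expectation (\<lambda>\<omega>. norm (X \<omega>)) + 2 * R)"
proof -
  have "distortion A
      \<le> (\<integral>\<omega>. sq_dist_to_grid B (X \<omega>) + \<delta> * (2 * norm (X \<omega>) + 2 * R) \<partial>M)"
    unfolding distortion_def
    using integrable_norm integrable_sq_dist_to_grid[OF A] integrable_sq_dist_to_grid[OF B]
    by (intro integral_mono sq_dist_to_grid_perturbation assms) auto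
  also have "\<dots> = distortion B + \<delta> * (2 * expectation (\<lambda>\<omega>. norm (X \<omega>)) + 2 * R)"
    unfolding distortion_def using integrable_norm integrable_sq_dist_to_grid[OF B]
    by (simp add: prob_space)
  finally show ?thesis .
qed

text \<open>
  Since \<open>l\<close> is allowed to be non-injective on \<open>I\<close>, the bound applies to a limit whose components
  have merged; when no grid with fewer points has distortion at most \<open>c\<close>, this rules merging out.
\<close>

lemma distortion_limit_le:
  assumes I: "finite I" "I \<noteq> {}"
    and lim: "\<And>i. i \<in> I \<Longrightarrow> (\<lambda>k. y k i) \<longlonglongrightarrow> l i"
    and bnd: "\<And>k. y k ` I \<subseteq> cball 0 R"
    and le: "\<And>k. distortion (y k ` I) \<le> c"
  shows "distortion (l ` I) \<le> c"
proof -
  have l_bnd: "l ` I \<subseteq> cball 0 R"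
  proof (rule image_subsetI)
    fix i assume i: "i \<in> I"
    have "\<forall>k. y k i \<in> cball 0 R" using bnd i by blast
    then show "l i \<in> cball 0 R"
      using closed_sequentially[OF closed_cball _ lim[OF i]] by blast
  qed
  define \<delta> where "\<delta> k = (\<Sum>i\<in>I. norm (l i - y k i))" for k
  define K where "K = 2 * expectation (\<lambda>\<omega>. norm (X \<omega>)) + 2 * R"
  have bound: "distortion (l ` I) \<le> c + \<delta> k * K" for k
  proof -
    have "norm (l i - y k i) \<le> \<delta> k" if "i \<in> I" for i
      unfolding \<delta>_def using member_le_sum[OF that, of "\<lambda>i. norm (l i - y k i)"] I(1) by simp
    then have "\<exists>a\<in>l ` I. norm (a - b) \<le> \<delta> k" if "b \<in> y k ` I" for b using that by blast
    then have "distortion (l ` I) \<le> distortion (y k ` I) + \<delta> k * K"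
      unfolding K_def using I l_bnd bnd by (intro distortion_le_perturbation) auto
    then show ?thesis using le[of k] by linarith
  qed
  have "(\<lambda>k. norm (l i - y k i)) \<longlonglongrightarrow> 0" if "i \<in> I" for i
    using tendsto_norm_zero[OF LIM_zero[OF lim[OF that]]] by (simp add: norm_minus_commute)
  then have "\<delta> \<longlonglongrightarrow> 0" unfolding \<delta>_def by (rule tendsto_null_sum)
  then have "(\<lambda>k. c + \<delta> k * K) \<longlonglongrightarrow> c + 0 * K" by (intro tendsto_intros)
  then have "distortion (l ` I) \<le> c + 0 * K"
    by (rule LIMSEQ_le_const) (use bound in blast)
  then show ?thesis by simp
qed

section \<open>Adding a point of the support\<close>

text \<open>
  Within a third of the distance \<open>\<delta>\<close> from \<open>b\<close> to the grid, \<open>b\<close> is strictly closer than the grid, by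
  at least \<open>(2\<delta>/3)\<^sup>2 - (\<delta>/3)\<^sup>2 = \<delta>\<^sup>2/3\<close> in squared distance, and \<open>X\<close> takes values there with
  positive probability.
\<close>

lemma distortion_insert_support_less:
  assumes A: "finite A" "A \<noteq> {}" and b: "b \<in> measure_support (distr M borel X)" "b \<notin> A"
  shows "distortion (insert b A) < distortion A"
proof -
  obtain \<delta> where \<delta>: "\<delta> > 0" "\<And>a. a \<in> A \<Longrightarrow> \<delta> \<le> dist b a"
    using finite_set_avoid[OF A(1), of b] b(2) by metis
  define W where "W = ball b (\<delta> / 3)"
  define S where "S = X -` W \<inter> space M"
  have S: "S \<in> sets M" unfolding S_def W_def by measurable
  have "0 < emeasure (distr M borel X) W"
    using b(1) \<delta>(1) unfolding measure_support_def W_def by auto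
  then have "0 < emeasure M S" unfolding S_def by (subst (asm) emeasure_distr) (auto simp: W_def)
  then have S_pos: "0 < prob S" by (simp add: emeasure_eq_measure)
  have gain: "sq_dist_to_grid (insert b A) (X \<omega>) + \<delta>\<^sup>2 / 3 * indicator S \<omega>
      \<le> sq_dist_to_grid A (X \<omega>)" for \<omega>
  proof (cases "\<omega> \<in> S")
    case True
    then have near: "norm (X \<omega> - b) \<le> \<delta> / 3"
      by (simp add: S_def W_def dist_norm norm_minus_commute)
    obtain a where a: "a \<in> A" "sq_dist_to_grid A (X \<omega>) = (norm (X \<omega> - a))\<^sup>2"
      using A by (rule sq_dist_to_grid_nearest)
    have "dist b a \<le> norm (X \<omega> - b) + norm (X \<omega> - a)"
      using dist_triangle[of b a "X \<omega>"] by (simp add: dist_norm norm_minus_commute)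
    then have "2 * \<delta> / 3 \<le> norm (X \<omega> - a)" using \<delta>(2)[OF a(1)] near by linarith
    then have "(2 * \<delta> / 3)\<^sup>2 \<le> (norm (X \<omega> - a))\<^sup>2" using \<delta>(1) by (intro power_mono) auto
    moreover have "(norm (X \<omega> - b))\<^sup>2 \<le> (\<delta> / 3)\<^sup>2" using near by (intro power_mono) auto
    moreover have "sq_dist_to_grid (insert b A) (X \<omega>) \<le> (norm (X \<omega> - b))\<^sup>2"
      using A by (intro sq_dist_to_grid_le) auto
    ultimately show ?thesis using True a(2) by (simp add: power_divide power_mult_distrib)
  next
    case False
    then show ?thesis using A by (auto intro: sq_dist_to_grid_antimono)
  qed
  have int: "integrable M (\<lambda>\<omega>. sq_dist_to_grid (insert b A) (X \<omega>))"
    using A by (intro integrable_sq_dist_to_grid) auto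
  have S_int: "integrable M (\<lambda>\<omega>. \<delta>\<^sup>2 / 3 * indicator S \<omega>)"
    using S by (intro integrable_mult_right) (simp add: emeasure_eq_measure)
  have "distortion (insert b A) + \<delta>\<^sup>2 / 3 * prob S
      = (\<integral>\<omega>. sq_dist_to_grid (insert b A) (X \<omega>) + \<delta>\<^sup>2 / 3 * indicator S \<omega> \<partial>M)"
    unfolding distortion_def using int S_int S by (subst Bochner_Integration.integral_add) auto
  also have "\<dots> \<le> distortion A"
    unfolding distortion_def using int S_int A
    by (intro integral_mono gain integrable_sq_dist_to_grid) auto
  finally have "distortion (insert b A) + \<delta>\<^sup>2 / 3 * prob S \<le> distortion A" .
  moreover have "0 < \<delta>\<^sup>2 / 3 * prob S" using \<delta>(1) S_pos by simp
  ultimately show ?thesis by linarith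
qed

section \<open>A Lloyd step does not increase the distortion\<close>

text \<open>
  With \<open>p = P(X \<in> C a) > 0\<close> and \<open>m\<close> the conditional mean of \<open>X\<close> on the cell, the right-hand side
  exceeds the left-hand side by \<open>p \<bar>m - a\<bar>\<^sup>2\<close>. On a cell with \<open>p = 0\<close> the point is kept, and the two sides agree.
\<close>

lemma lloyd_update_improves_on_cell:
  assumes C: "C a \<in> sets borel"
  shows "(\<integral>\<omega>. indicator (C a) (X \<omega>) * (norm (X \<omega> - lloyd_update M X C a))\<^sup>2 \<partial>M)
    \<le> (\<integral>\<omega>. indicator (C a) (X \<omega>) * (norm (X \<omega> - a))\<^sup>2 \<partial>M)"
proof -
  define p where "p = prob {\<omega> \<in> space M. X \<omega> \<in> C a}"
  define m where "m = lloyd_update M X C a"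
  define I where "I = (\<lambda>\<omega>. indicator (C a) (X \<omega>) :: real)"
  have C_meas: "{\<omega> \<in> space M. X \<omega> \<in> C a} \<in> sets M" using C by measurable
  have I_meas: "I \<in> borel_measurable M" unfolding I_def using C by measurable
  have p_nonneg: "0 \<le> p" by (simp add: p_def)
  show ?thesis
  proof (cases "p > 0")
    case False
    then show ?thesis by (simp add: lloyd_update_def p_def)
  next
    case True
    have IX: "integrable M (\<lambda>\<omega>. I \<omega> *\<^sub>R X \<omega>)"
      using I_meas
      by (intro Bochner_Integration.integrable_bound[OF integrable_vector])
        (auto simp: I_def indicator_def)
    have I_eq: "I \<omega> = indicator {\<omega> \<in> space M. X \<omega> \<in> C a} \<omega>" if "\<omega> \<in> space M" for \<omega>
      using that by (simp add: I_def indicator_def)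
    have I_int: "integrable M I"
      using C_meas by (subst Bochner_Integration.integrable_cong[OF refl I_eq]) (auto simp: emeasure_eq_measure)
    have p_eq: "(\<integral>\<omega>. I \<omega> \<partial>M) = p"
      using C_meas by (subst Bochner_Integration.integral_cong[OF refl I_eq]) (auto simp: p_def)
    have m_eq: "(\<integral>\<omega>. I \<omega> *\<^sub>R X \<omega> \<partial>M) = p *\<^sub>R m"
      using True unfolding m_def lloyd_update_def p_def[symmetric] I_def by simp
    have sq_int: "integrable M (\<lambda>\<omega>. I \<omega> * (norm (X \<omega> - c))\<^sup>2)" for c
      using I_meas
      by (intro Bochner_Integration.integrable_bound[OF integrable_sq_dist[of c]])
        (auto simp: I_def indicator_def)
    have expand: "I \<omega> * (norm (X \<omega> - a))\<^sup>2 - I \<omega> * (norm (X \<omega> - m))\<^sup>2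
        = 2 * ((I \<omega> *\<^sub>R X \<omega>) \<bullet> (m - a)) + I \<omega> * ((norm a)\<^sup>2 - (norm m)\<^sup>2)" for \<omega>
      by (simp add: power2_norm_eq_inner algebra_simps inner_commute)
    have "(\<integral>\<omega>. I \<omega> * (norm (X \<omega> - a))\<^sup>2 \<partial>M) - (\<integral>\<omega>. I \<omega> * (norm (X \<omega> - m))\<^sup>2 \<partial>M)
        = (\<integral>\<omega>. 2 * ((I \<omega> *\<^sub>R X \<omega>) \<bullet> (m - a)) + I \<omega> * ((norm a)\<^sup>2 - (norm m)\<^sup>2) \<partial>M)"
      unfolding expand[symmetric] using sq_int by simp
    also have "\<dots> = 2 * ((\<integral>\<omega>. I \<omega> *\<^sub>R X \<omega> \<partial>M) \<bullet> (m - a)) + (\<integral>\<omega>. I \<omega> \<partial>M) * ((norm a)\<^sup>2 - (norm m)\<^sup>2)"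
      using IX I_int
      by (subst Bochner_Integration.integral_add) (auto simp del: inner_scaleR_left)
    also have "\<dots> = p * (norm (m - a))\<^sup>2"
      unfolding m_eq p_eq by (simp add: power2_norm_eq_inner algebra_simps inner_commute)
    finally show ?thesis
      using mult_nonneg_nonneg[OF p_nonneg zero_le_power2[of "norm (m - a)"]]
      unfolding I_def m_def by linarith
  qed
qed

lemma distortion_lloyd_le:
  assumes V: "voronoi_partition A C" and A: "finite A" "A \<noteq> {}"
  shows "distortion (lloyd_update M X C ` A) \<le> distortion A"
proof -
  let ?T = "lloyd_update M X C"
  have C: "C a \<in> sets borel" if "a \<in> A" for a
    using V that unfolding voronoi_partition_def by blast
  have int: "integrable M (\<lambda>\<omega>. indicator (C a) (X \<omega>) * (norm (X \<omega> - c))\<^sup>2)" if "a \<in> A" for a c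
    using C[OF that]
    by (intro Bochner_Integration.integrable_bound[OF integrable_sq_dist[of c]])
      (auto simp: indicator_def)
  have new: "sq_dist_to_grid (?T ` A) \<xi> \<le> (\<Sum>a\<in>A. indicator (C a) \<xi> * (norm (\<xi> - ?T a))\<^sup>2)" for \<xi>
  proof (rule sum_over_cells[OF V A(1), of \<xi>])
    fix a assume a: "a \<in> A" and s: "\<And>g. (\<Sum>b\<in>A. indicator (C b) \<xi> * g b) = (g a :: real)"
    show ?thesis unfolding s using a A by (intro sq_dist_to_grid_le) auto
  qed
  have old: "(\<Sum>a\<in>A. indicator (C a) \<xi> * (norm (\<xi> - a))\<^sup>2) = sq_dist_to_grid A \<xi>" for \<xi>
  proof (rule sum_over_cells[OF V A(1), of \<xi>])
    fix a assume a: "a \<in> A" "\<xi> \<in> C a"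
      and s: "\<And>g. (\<Sum>b\<in>A. indicator (C b) \<xi> * g b) = (g a :: real)"
    show ?thesis unfolding s using sq_dist_to_grid_in_cell[OF V A(1) a] by simp
  qed
  have "distortion (?T ` A)
      \<le> (\<integral>\<omega>. (\<Sum>a\<in>A. indicator (C a) (X \<omega>) * (norm (X \<omega> - ?T a))\<^sup>2) \<partial>M)"
    unfolding distortion_def using A int
    by (intro integral_mono new integrable_sq_dist_to_grid Bochner_Integration.integrable_sum) auto
  also have "\<dots> = (\<Sum>a\<in>A. \<integral>\<omega>. indicator (C a) (X \<omega>) * (norm (X \<omega> - ?T a))\<^sup>2 \<partial>M)"
    using int by (intro Bochner_Integration.integral_sum) auto
  also have "\<dots> \<le> (\<Sum>a\<in>A. \<integral>\<omega>. indicator (C a) (X \<omega>) * (norm (X \<omega> - a))\<^sup>2 \<partial>M)"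
    using C by (intro sum_mono lloyd_update_improves_on_cell)
  also have "\<dots> = (\<integral>\<omega>. (\<Sum>a\<in>A. indicator (C a) (X \<omega>) * (norm (X \<omega> - a))\<^sup>2) \<partial>M)"
    using int by (intro Bochner_Integration.integral_sum[symmetric]) auto
  also have "\<dots> = distortion A" unfolding old distortion_def ..
  finally show ?thesis .
qed

section \<open>Grids of small distortion are bounded\<close>

lemma second_moment_tail_tendsto_0:
  "(\<lambda>n. \<integral>\<omega>. indicator {r. real n \<le> r} (norm (X \<omega>)) * (2 * (norm (X \<omega>))\<^sup>2 + c) \<partial>M) \<longlonglongrightarrow> 0"
proof -
  let ?w = "\<lambda>\<omega>. 2 * (norm (X \<omega>))\<^sup>2 + \<bar>c\<bar>"
  let ?s = "\<lambda>n \<omega>. indicator {r. real n \<le> r} (norm (X \<omega>)) * (2 * (norm (X \<omega>))\<^sup>2 + c)"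
  have "(\<lambda>n. integral\<^sup>L M (?s n)) \<longlonglongrightarrow> (\<integral>\<omega>. 0 \<partial>M)"
  proof (rule integral_dominated_convergence[where w = ?w])
    show "integrable M ?w"
      using sq_integrable by (intro Bochner_Integration.integrable_add integrable_mult_right) auto
    show "AE \<omega> in M. (\<lambda>n. ?s n \<omega>) \<longlonglongrightarrow> 0"
    proof (rule AE_I2)
      fix \<omega>
      obtain n0 where n0: "norm (X \<omega>) < real n0" using reals_Archimedean2 by blast
      have "\<forall>\<^sub>F n in sequentially. ?s n \<omega> = 0"
        using eventually_ge_at_top[of n0] by eventually_elim (use n0 in auto)
      then show "(\<lambda>n. ?s n \<omega>) \<longlonglongrightarrow> 0" by (rule tendsto_eventually)
    qed
    show "AE \<omega> in M. norm (?s n \<omega>) \<le> ?w \<omega>" for n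
    proof (rule AE_I2)
      fix \<omega>
      have "\<bar>2 * (norm (X \<omega>))\<^sup>2 + c\<bar> \<le> ?w \<omega>"
        using abs_triangle_ineq[of "2 * (norm (X \<omega>))\<^sup>2" c] by simp
      then show "norm (?s n \<omega>) \<le> ?w \<omega>" by (simp add: indicator_def)
    qed
  qed measurable
  then show ?thesis by simp
qed

text \<open>
  If every point of \<open>A\<close> has norm at least \<open>B\<close>, then \<open>B\<^sup>2 \<le> \<bar>a\<bar>\<^sup>2 \<le> 2 \<bar>\<xi>\<bar>\<^sup>2 + 2 \<bar>\<xi> - a\<bar>\<^sup>2\<close>
  for the point \<open>a\<close> nearest to \<open>\<xi>\<close>; now average over \<open>\<xi> = X\<close>.
\<close>

lemma distortion_ge_of_far:
  assumes A: "finite A" "A \<noteq> {}" and far: "\<And>a. a \<in> A \<Longrightarrow> B \<le> norm a" and B: "0 \<le> B"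
  shows "B\<^sup>2 \<le> 2 * expectation (\<lambda>\<omega>. (norm (X \<omega>))\<^sup>2) + 2 * distortion A"
proof -
  have "B\<^sup>2 \<le> 2 * (norm \<xi>)\<^sup>2 + 2 * sq_dist_to_grid A \<xi>" for \<xi>
  proof -
    obtain a where a: "a \<in> A" "sq_dist_to_grid A \<xi> = (norm (\<xi> - a))\<^sup>2"
      using A by (rule sq_dist_to_grid_nearest)
    have "B\<^sup>2 \<le> (norm a)\<^sup>2" using far[OF a(1)] B by (intro power_mono)
    then show ?thesis using norm_diff_squared_le[of \<xi> "\<xi> - a"] a(2) by simp
  qed
  then have "(\<integral>\<omega>. B\<^sup>2 \<partial>M) \<le> (\<integral>\<omega>. 2 * (norm (X \<omega>))\<^sup>2 + 2 * sq_dist_to_grid A (X \<omega>) \<partial>M)"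
    using sq_integrable integrable_sq_dist_to_grid[OF A] by (intro integral_mono) auto
  also have "\<dots> = 2 * expectation (\<lambda>\<omega>. (norm (X \<omega>))\<^sup>2) + 2 * distortion A"
    unfolding distortion_def using sq_integrable integrable_sq_dist_to_grid[OF A] by simp
  finally show ?thesis by (simp add: prob_space)
qed

text \<open>
  A far point \<open>a\<close> is removed while some \<open>b\<close> of moderate norm remains. If \<open>\<xi>\<close> is nearest to \<open>a\<close>,
  then \<open>\<bar>a\<bar> - \<bar>\<xi>\<bar> \<le> \<bar>\<xi> - a\<bar> \<le> \<bar>\<xi> - b\<bar> \<le> \<bar>\<xi>\<bar> + B\<close>, so \<open>\<xi>\<close> itself is large.
\<close>

lemma sq_dist_to_grid_remove_far:
  assumes A: "finite A" and a: "2 * r + B \<le> norm a" and b: "b \<in> A" "b \<noteq> a" "norm b \<le> B"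
  shows "sq_dist_to_grid (A - {a}) \<xi>
    \<le> sq_dist_to_grid A \<xi> + indicator {t. r \<le> t} (norm \<xi>) * (2 * (norm \<xi>)\<^sup>2 + 2 * B\<^sup>2)"
proof -
  have A': "finite (A - {a})" "b \<in> A - {a}" using A b by auto
  obtain c where c: "c \<in> A" "sq_dist_to_grid A \<xi> = (norm (\<xi> - c))\<^sup>2"
    using A b(1) by (metis sq_dist_to_grid_nearest empty_iff)
  show ?thesis
  proof (cases "c = a")
    case False
    then have "sq_dist_to_grid (A - {a}) \<xi> \<le> sq_dist_to_grid A \<xi>"
      using sq_dist_to_grid_le[OF A'(1), of c \<xi>] c by simp
    then show ?thesis by (simp add: add_increasing2)
  next
    case True
    have "(norm (\<xi> - a))\<^sup>2 \<le> (norm (\<xi> - b))\<^sup>2"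
      using sq_dist_to_grid_le[OF A b(1), of \<xi>] c(2) True by simp
    then have "norm (\<xi> - a) \<le> norm (\<xi> - b)" by (simp add: power2_le_iff_abs_le)
    moreover have "norm a - norm \<xi> \<le> norm (\<xi> - a)"
      using norm_triangle_ineq2[of a \<xi>] by (simp add: norm_minus_commute)
    moreover have "norm (\<xi> - b) \<le> norm \<xi> + B" using norm_triangle_ineq4[of \<xi> b] b(3) by linarith
    ultimately have "r \<le> norm \<xi>" using a by linarith
    moreover have "sq_dist_to_grid (A - {a}) \<xi> \<le> 2 * (norm \<xi>)\<^sup>2 + 2 * (norm b)\<^sup>2"
      using sq_dist_to_grid_le[OF A', of \<xi>] norm_diff_squared_le[of \<xi> b] by linarith
    moreover have "(norm b)\<^sup>2 \<le> B\<^sup>2" using b(3) by (intro power_mono) auto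
    moreover have "0 \<le> sq_dist_to_grid A \<xi>" using c(2) by simp
    ultimately show ?thesis by simp
  qed
qed

text \<open>
  The radius depends only on the two levels \<open>c < d\<close>: the first step gives a point of norm at most
  \<open>B\<close> in every grid of distortion at most \<open>c\<close>, the second shows that deleting a point of norm
  beyond \<open>2n + B\<close> would raise the distortion by less than \<open>d - c\<close>.
\<close>

lemma grids_below_removal_level_bounded:
  assumes cd: "c < d"
  shows "\<exists>R. \<forall>A. finite A \<and> A \<noteq> {} \<and> distortion A \<le> c \<and>
      (\<forall>a\<in>A. A - {a} \<noteq> {} \<longrightarrow> d \<le> distortion (A - {a})) \<longrightarrow> A \<subseteq> cball 0 R"
proof -
  define E where "E = expectation (\<lambda>\<omega>. (norm (X \<omega>))\<^sup>2)"
  \<comment> \<open>Large enough to contradict \<open>distortion_ge_of_far\<close>; adding \<open>1\<close> makes the inequality strict.\<close>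
  define B where "B = sqrt (2 * E + 2 * \<bar>c\<bar>) + 1"
  have E: "0 \<le> E" unfolding E_def by simp
  have B: "0 \<le> B" "2 * E + 2 * c < B\<^sup>2"
  proof -
    have "sqrt (2 * E + 2 * \<bar>c\<bar>) < B" unfolding B_def by simp
    then have "(sqrt (2 * E + 2 * \<bar>c\<bar>))\<^sup>2 < B\<^sup>2" using E by (intro power_strict_mono) auto
    then show "2 * E + 2 * c < B\<^sup>2" using E by simp
    show "0 \<le> B" unfolding B_def using E by simp
  qed
  let ?tail = "\<lambda>n \<omega>. indicator {r. real n \<le> r} (norm (X \<omega>)) * (2 * (norm (X \<omega>))\<^sup>2 + 2 * B\<^sup>2)"
  have "\<forall>\<^sub>F n in sequentially. integral\<^sup>L M (?tail n) < d - c"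
    using second_moment_tail_tendsto_0[of "2 * B\<^sup>2"] cd by (intro order_tendstoD(2)) auto
  then obtain n where n: "integral\<^sup>L M (?tail n) < d - c"
    using eventually_happens' sequentially_bot by blast
  have tail_int: "integrable M (?tail n)"
  proof (rule Bochner_Integration.integrable_bound)
    show "integrable M (\<lambda>\<omega>. 2 * (norm (X \<omega>))\<^sup>2 + 2 * B\<^sup>2)" using sq_integrable by simp
  qed (auto simp: indicator_def)
  have "A \<subseteq> cball 0 (2 * real n + B)"
    if A: "finite A" "A \<noteq> {}" "distortion A \<le> c"
      and rem: "\<forall>a\<in>A. A - {a} \<noteq> {} \<longrightarrow> d \<le> distortion (A - {a})" for A
  proof (rule ccontr)
    assume "\<not> A \<subseteq> cball 0 (2 * real n + B)"
    then obtain a where a: "a \<in> A" "2 * real n + B < norm a"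
      by (metis mem_cball_0 not_le subsetI)
    have "\<exists>b\<in>A. norm b < B"
    proof (rule ccontr)
      assume "\<not> (\<exists>b\<in>A. norm b < B)"
      then have "B \<le> norm b" if "b \<in> A" for b using that by (meson not_less)
      then have "B\<^sup>2 \<le> 2 * E + 2 * distortion A"
        unfolding E_def using A B(1) by (intro distortion_ge_of_far)
      then show False using A(3) B(2) by linarith
    qed
    then obtain b where b: "b \<in> A" "norm b < B" by blast
    have ba: "b \<noteq> a" using a(2) b(2) by auto
    then have A': "finite (A - {a})" "A - {a} \<noteq> {}" using A(1) b(1) by auto
    have "distortion (A - {a}) \<le> (\<integral>\<omega>. sq_dist_to_grid A (X \<omega>) + ?tail n \<omega> \<partial>M)"
      unfolding distortion_def
      using integrable_sq_dist_to_grid[OF A'] integrable_sq_dist_to_grid[OF A(1,2)] tail_int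
        A(1) a(2) b ba
      by (intro integral_mono sq_dist_to_grid_remove_far) auto
    also have "\<dots> = distortion A + integral\<^sup>L M (?tail n)"
      unfolding distortion_def using integrable_sq_dist_to_grid[OF A(1,2)] tail_int
      by (intro Bochner_Integration.integral_add)
    finally show False using rem[rule_format, OF a(1) A'(2)] A(3) n by linarith
  qed
  then show ?thesis by blast
qed

section \<open>Comparison with the minimal error\<close>

lemma minimal_quantization_error_le:
  assumes "finite A" "1 \<le> card A" "card A \<le> n"
  shows "minimal_quantization_error M X n \<le> quantization_error M X A"
  unfolding minimal_quantization_error_def
proof (rule cInf_lower)
  show "bdd_below {quantization_error M X \<Gamma> |\<Gamma>. finite \<Gamma> \<and> 1 \<le> card \<Gamma> \<and> card \<Gamma> \<le> n}"
  proof (rule bdd_belowI[of _ 0])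
    fix e assume "e \<in> {quantization_error M X \<Gamma> |\<Gamma>. finite \<Gamma> \<and> 1 \<le> card \<Gamma> \<and> card \<Gamma> \<le> n}"
    then obtain \<Gamma> where "e = quantization_error M X \<Gamma>" "finite \<Gamma>" "\<Gamma> \<noteq> {}" by force
    then show "0 \<le> e" by (simp add: quantization_error_eq_sqrt distortion_nonneg)
  qed
qed (use assms in auto)

end

theorem proposition2p1:
  fixes M :: "'w measure"
    and X :: "'w \<Rightarrow> 'a::euclidean_space"
    and U \<Gamma>opt :: "'a set"
    and C :: "'a set \<Rightarrow> 'a \<Rightarrow> 'a set"
    and N :: nat
    and \<Gamma> :: "nat \<Rightarrow> 'a set"
    and x :: "nat \<Rightarrow> nat \<Rightarrow> 'a"
  assumes "closed U" and "convex U" and "interior U \<noteq> {}"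
    and "prob_space M"
    and "X \<in> borel_measurable M"
    and "integrable M (\<lambda>\<omega>. (norm (X \<omega>))\<^sup>2)"
    and "measure_support (distr M borel X) \<subseteq> U"
    and "N \<ge> 2"
    and "finite (measure_support (distr M borel X)) \<longrightarrow>
           card (measure_support (distr M borel X)) > N"
    and "\<forall>A. finite A \<and> A \<noteq> {} \<longrightarrow> voronoi_partition A (C A)"
    and "\<Gamma>opt \<subseteq> U" and "finite \<Gamma>opt" and "card \<Gamma>opt = N - 1"
    and "quantization_error M X \<Gamma>opt = minimal_quantization_error M X (N - 1)"
    and "x 0 N \<in> measure_support (distr M borel X) - \<Gamma>opt"
    and "\<Gamma> 0 = \<Gamma>opt \<union> {x 0 N}"
    and "consistent_representation M X C N \<Gamma> x"
  shows "(quantization_error M X (\<Gamma> 0) < minimal_quantization_error M X (N - 1) \<and>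
          (\<forall>k. card (\<Gamma> k) = N \<and>
               quantization_error M X (\<Gamma> k) \<le> quantization_error M X (\<Gamma> 0))) \<and>
         (\<exists>K. compact K \<and> (\<forall>k. \<Gamma> k \<subseteq> K)) \<and>
         (\<forall>r l. strict_mono (r :: nat \<Rightarrow> nat) \<and>
                (\<forall>i\<in>{1..N}. (\<lambda>k. x (r k) i) \<longlonglongrightarrow> l i) \<longrightarrow>
                inj_on l {1..N})"
proof -
  interpret square_integrable_vector M X
    using assms(4-6) by (simp add: square_integrable_vector_def square_integrable_vector_axioms_def)
  note N = \<open>N \<ge> 2\<close>
  have opt: "finite \<Gamma>opt" "\<Gamma>opt \<noteq> {}" "card \<Gamma>opt = N - 1" using assms(8,12,13) by auto
  define d where "d = distortion \<Gamma>opt"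
  define c where "c = distortion (\<Gamma> 0)"
  have d: "minimal_quantization_error M X (N - 1) = sqrt d"
    using assms(14) by (simp add: quantization_error_eq_sqrt d_def)
  have d_le: "d \<le> distortion A" if "finite A" "A \<noteq> {}" "card A < N" for A
  proof -
    have "1 \<le> card A" "card A \<le> N - 1" using that card_gt_0_iff[of A] by linarith+
    then have "sqrt d \<le> sqrt (distortion A)"
      unfolding d[symmetric] quantization_error_eq_sqrt[symmetric]
      using that(1) by (intro minimal_quantization_error_le)
    then show ?thesis by simp
  qed
  have card_ge: "N \<le> card A" if "finite A" "A \<noteq> {}" "distortion A < d" for A
    using d_le[OF that(1,2)] that(3) by force
  have cd: "c < d"
    unfolding c_def d_def assms(16) using distortion_insert_support_less[OF opt(1,2)] assms(15) by auto

  have G: "\<Gamma> k = x k ` {1..N}" for k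
    using assms(17) unfolding consistent_representation_def by blast
  have fin: "finite (\<Gamma> k)" "\<Gamma> k \<noteq> {}" for k unfolding G using N by auto
  have step: "\<Gamma> (Suc k) = lloyd_update M X (C (\<Gamma> k)) ` \<Gamma> k" for k
  proof -
    have "x (Suc k) i = lloyd_update M X (C (\<Gamma> k)) (x k i)" if "i \<in> {1..N}" for i
      using assms(17) that unfolding consistent_representation_def by blast
    then show ?thesis unfolding G[of "Suc k"] G[of k] image_image
      by (intro image_cong) (auto simp: G)
  qed
  have le_c: "distortion (\<Gamma> k) \<le> c" for k
  proof (induction k)
    case (Suc k)
    have "distortion (\<Gamma> (Suc k)) \<le> distortion (\<Gamma> k)"
      unfolding step using assms(10) fin by (intro distortion_lloyd_le) auto
    then show ?case using Suc by linarith
  qed (simp add: c_def)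
  have card: "card (\<Gamma> k) = N" for k
  proof (rule antisym)
    show "card (\<Gamma> k) \<le> N" unfolding G using card_image_le[of "{1..N}" "x k"] by simp
    show "N \<le> card (\<Gamma> k)" using le_c[of k] cd by (intro card_ge fin) linarith
  qed

  have removal: "d \<le> distortion (\<Gamma> k - {a})" if "a \<in> \<Gamma> k" "\<Gamma> k - {a} \<noteq> {}" for a k
    using that fin[of k] card[of k] N by (intro d_le) auto
  obtain R where R: "\<forall>A. finite A \<and> A \<noteq> {} \<and> distortion A \<le> c \<and>
      (\<forall>a\<in>A. A - {a} \<noteq> {} \<longrightarrow> d \<le> distortion (A - {a})) \<longrightarrow> A \<subseteq> cball 0 R"
    using grids_below_removal_level_bounded[OF cd] by (elim exE)
  have bnd: "\<Gamma> k \<subseteq> cball 0 R" for k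
    using fin[of k] le_c[of k] removal[of _ k] by (intro R[rule_format] conjI ballI impI)

  have inj: "inj_on l {1..N}"
    if lim: "\<forall>i\<in>{1..N}. (\<lambda>k. x (r k) i) \<longlonglongrightarrow> l i" for r :: "nat \<Rightarrow> nat" and l
  proof (rule eq_card_imp_inj_on)
    have "distortion (l ` {1..N}) \<le> c"
    proof (rule distortion_limit_le)
      show "(\<lambda>k. x (r k) i) \<longlonglongrightarrow> l i" if "i \<in> {1..N}" for i using lim that by blast
      show "x (r k) ` {1..N} \<subseteq> cball 0 R" for k using bnd[of "r k"] by (simp only: G)
      show "distortion (x (r k) ` {1..N}) \<le> c" for k using le_c[of "r k"] by (simp only: G)
    qed (use N in auto)
    then have "N \<le> card (l ` {1..N})" using N cd by (intro card_ge) auto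
    then show "card (l ` {1..N}) = card {1..N}"
      using card_image_le[of "{1..N}" l] by simp
  qed simp
  show ?thesis
  proof (intro conjI allI impI)
    show "quantization_error M X (\<Gamma> 0) < minimal_quantization_error M X (N - 1)"
      unfolding d quantization_error_eq_sqrt using cd unfolding c_def by simp
    show "card (\<Gamma> k) = N" for k by (rule card)
    show "quantization_error M X (\<Gamma> k) \<le> quantization_error M X (\<Gamma> 0)" for k
      unfolding quantization_error_eq_sqrt using le_c[of k] unfolding c_def by simp
    show "\<exists>K. compact K \<and> (\<forall>k. \<Gamma> k \<subseteq> K)"
      using bnd by (intro exI[of _ "cball 0 R"] conjI allI compact_cball)
    show "inj_on l {1..N}"
      if "strict_mono r \<and> (\<forall>i\<in>{1..N}. (\<lambda>k. x (r k) i) \<longlonglongrightarrow> l i)" for r l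
      using that by (intro inj) (rule conjunct2)
  qed
qed

end
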